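(* Let $n\ge1$ and $Q=2n+2$. If $1<q<\frac{n+1}{n}$ and $\Phi$ is an Orlicz function with $0<I(\Phi)<Q\,(2+\frac{Q}{q})^{-1}$, then $\mathcal{H}^{\Phi}_{q,2}(\mathbb{H}^n)=\{0\}$.
   Context: $\mathbb{H}^n$ is $\mathbb{R}^{2n}\times\mathbb{R}$ with the group law $(x,t)\cdot(y,s)=(x+y,\,t+s+x^{t}Jy)$, $J=2\begin{pmatrix}0&-I_n\\ I_n&0\end{pmatrix}$, $(x,t)^{-1}=(-x,-t)$. Koranyi norm: $\rho(x,t)=(|x|^4+t^2)^{1/4}$. Balls: $B(z_0,\delta)=\{w:\rho(z_0^{-1}\cdot w)<\delta\}$. Haar measure is Lebesgue measure on $\mathbb{R}^{2n+1}$; $|E|$ is the measure of $E$. For a multi-index $I=(i_1,\dots,i_{2n+1})$ of non-negative integers, $d(I)=i_1+\dots+i_{2n}+2i_{2n+1}$ and $z^I=x_1^{i_1}\cdots x_{2n}^{i_{2n}}t^{i_{2n+1}}$; $\mathcal{P}_1$ is the space of polynomials $\sum_{d(I)\le1}c_Iz^I$, $c_I\in\mathbb{C}$. An Orlicz function is a non-decreasing $\Phi:[0,\infty)\to[0,\infty)$ with $\lim_{t\to0^+}\Phi(t)=\Phi(0)=0$, $\Phi(t)>0$ for $t>0$, $\lim_{t\to\infty}\Phi(t)=\infty$, and such that $z\mapsto\Phi(|f(z)|)$ is measurable for every measurable $f$ on $\mathbb{H}^n$. $\|f\|_\Phi=\inf\{\lambda>0:\int_{\mathbb{H}^n}\Phi(|f(z)|/\lambda)\,dz\le1\}$,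 and $L^\Phi(\mathbb{H}^n)$ is the set of measurable $f$ with $\|f\|_\Phi<\infty$. $\Phi$ is of positive upper type $p\in(0,\infty)$ if there is $C>0$ with $\Phi(rt)\le Cr^p\Phi(t)$ for all $t>0$ and $r\in[1,\infty)$. $I(\Phi)$ is the infimum of all $p$ such that $\Phi$ is of positive upper type $p$. For a ball $B$ and $g\in L^q_{loc}(\mathbb{H}^n)$ let $|g|_{q,B}=(|B|^{-1}\int_B|g|^q)^{1/q}$ and $\eta_{q,2}(g;z)=\sup_{r>0}r^{-2}|g|_{q,B(z,r)}$. $E^q_1$ is the quotient space $L^q_{loc}(\mathbb{H}^n)/\mathcal{P}_1$. For $G\in E^q_1$, $N_{q,2}(G;z)=\inf\{\eta_{q,2}(g;z):g\in G\}$. $\mathcal{H}^\Phi_{q,2}(\mathbb{H}^n)$ (the Orlicz-Calderón Hardy space) is the set of $G\in E^q_1$ with $N_{q,2}(G;\cdot)\in L^\Phi(\mathbb{H}^n)$. *)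

theory Defs
  imports "HOL-Analysis.Analysis"
begin

type_synonym 'n heis = "(real ^ ('n + 'n)) \<times> real"

text \<open>The block matrix with rows \<open>(0, -2 I)\<close> and \<open>(2 I, 0)\<close>.\<close>

definition heis_J :: "real ^ ('n::finite + 'n) ^ ('n + 'n)" where
  "heis_J = (\<chi> i j. case (i, j) of
      (Inl a, Inr b) \<Rightarrow> if a = b then - 2 else 0
    | (Inr a, Inl b) \<Rightarrow> if a = b then 2 else 0
    | _ \<Rightarrow> 0)"

definition heis_mult :: "'n::finite heis \<Rightarrow> 'n heis \<Rightarrow> 'n heis" where
  "heis_mult z w =
     (fst z + fst w, snd z + snd w + fst z \<bullet> (heis_J *v fst w))"

definition heis_inv :: "'n::finite heis \<Rightarrow> 'n heis" where
  "heis_inv z = (- fst z, - snd z)"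

definition koranyi :: "'n::finite heis \<Rightarrow> real" where
  "koranyi z = root 4 (norm (fst z) ^ 4 + snd z ^ 2)"

definition heis_ball :: "'n::finite heis \<Rightarrow> real \<Rightarrow> 'n heis set" where
  "heis_ball z \<delta> = {w. koranyi (heis_mult (heis_inv z) w) < \<delta>}"

text \<open>A multi-index is a pair of the exponents of the \<open>2n\<close> horizontal coordinates
  and the exponent of \<open>t\<close>.\<close>

type_synonym 'n multi_index = "(('n + 'n) \<Rightarrow> nat) \<times> nat"

definition hom_degree :: "'n::finite multi_index \<Rightarrow> nat" where
  "hom_degree I = (\<Sum>j\<in>UNIV. fst I j) + 2 * snd I"

definition heis_monomial :: "'n::finite multi_index \<Rightarrow> 'n heis \<Rightarrow> real" where
  "heis_monomial I z = (\<Prod>j\<in>UNIV. (fst z $ j) ^ fst I j) * snd z ^ snd I"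

lemma finite_hom_degree_le: "finite {I :: 'n::finite multi_index. hom_degree I \<le> k}"
proof (rule finite_subset)
  show "{I :: 'n multi_index. hom_degree I \<le> k} \<subseteq> (UNIV \<rightarrow>\<^sub>E {..k}) \<times> {..k}"
  proof
    fix I :: "'n multi_index"
    assume "I \<in> {I. hom_degree I \<le> k}"
    then have le: "(\<Sum>j\<in>UNIV. fst I j) + 2 * snd I \<le> k"
      by (simp add: hom_degree_def)
    have "fst I j \<le> (\<Sum>j\<in>UNIV. fst I j)" for j
      by (rule member_le_sum) auto
    then have "fst I j \<le> k" for j
      using le by (meson add_leD1 le_trans)
    then show "I \<in> (UNIV \<rightarrow>\<^sub>E {..k}) \<times> {..k}"
      using le by (auto simp: mem_Times_iff)
  qed
  show "finite (((UNIV :: ('n + 'n) set) \<rightarrow>\<^sub>E {..k}) \<times> {..k})"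
    by (intro finite_cartesian_product finite_PiE) auto
qed

definition heis_polys :: "nat \<Rightarrow> ('n::finite heis \<Rightarrow> complex) set" where
  "heis_polys k =
     {P. \<exists>c. P = (\<lambda>z. \<Sum>I | hom_degree I \<le> k. c I * complex_of_real (heis_monomial I z))}"

text \<open>The measurability clause refers to functions on the \<open>n\<close>-th Heisenberg group, hence
  the type argument. Only the values of \<open>\<Phi>\<close> on \<open>[0,\<infinity>)\<close> matter.\<close>

definition orlicz_function :: "'n::finite itself \<Rightarrow> (real \<Rightarrow> real) \<Rightarrow> bool" where
  "orlicz_function _ \<Phi> \<longleftrightarrow>
     (\<forall>t\<ge>0. 0 \<le> \<Phi> t) \<and> mono_on {0..} \<Phi> \<and>
     (\<Phi> \<longlongrightarrow> 0) (at_right 0) \<and> \<Phi> 0 = 0 \<and>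
     (\<forall>t>0. 0 < \<Phi> t) \<and> filterlim \<Phi> at_top at_top \<and>
     (\<forall>f :: 'n heis \<Rightarrow> complex. f \<in> borel_measurable lebesgue \<longrightarrow>
        (\<lambda>z. \<Phi> (norm (f z))) \<in> borel_measurable lebesgue)"

definition positive_upper_type :: "(real \<Rightarrow> real) \<Rightarrow> real \<Rightarrow> bool" where
  "positive_upper_type \<Phi> p \<longleftrightarrow>
     0 < p \<and> (\<exists>C>0. \<forall>t>0. \<forall>r\<ge>1. \<Phi> (r * t) \<le> C * r powr p * \<Phi> t)"

text \<open>The infimum is taken in the extended reals, so it is \<open>\<infinity>\<close> if \<open>\<Phi>\<close> has no
  positive upper type.\<close>

definition upper_index :: "(real \<Rightarrow> real) \<Rightarrow> ereal" where
  "upper_index \<Phi> = (INF p\<in>{p. positive_upper_type \<Phi> p}. ereal p)"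

text \<open>The maximal function below takes values in \<open>[0,\<infinity>]\<close>, so \<open>L\<^sup>\<Phi>\<close> is set up for
  \<open>[0,\<infinity>]\<close>-valued functions, with \<open>\<Phi>(\<infinity>) = lim \<Phi> = \<infinity>\<close>. In particular its members are
  finite almost everywhere.\<close>

definition orlicz_ext :: "(real \<Rightarrow> real) \<Rightarrow> ennreal \<Rightarrow> ennreal" where
  "orlicz_ext \<Phi> x = (if x = \<infinity> then \<infinity> else ennreal (\<Phi> (enn2real x)))"

definition luxemburg :: "(real \<Rightarrow> real) \<Rightarrow> ('n::finite heis \<Rightarrow> ennreal) \<Rightarrow> ennreal" where
  "luxemburg \<Phi> u =
     (INF s\<in>{s::real. 0 < s \<and>
        (\<integral>\<^sup>+ z. orlicz_ext \<Phi> (u z / ennreal s) \<partial>lebesgue) \<le> 1}. ennreal s)"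

definition orlicz_space :: "(real \<Rightarrow> real) \<Rightarrow> ('n::finite heis \<Rightarrow> ennreal) set" where
  "orlicz_space \<Phi> = {u. u \<in> borel_measurable lebesgue \<and> luxemburg \<Phi> u < \<infinity>}"

definition Lq_loc :: "real \<Rightarrow> ('n::finite heis \<Rightarrow> complex) set" where
  "Lq_loc q = {g. g \<in> borel_measurable lebesgue \<and>
     (\<forall>K. compact K \<longrightarrow> set_integrable lebesgue K (\<lambda>w. norm (g w) powr q))}"

definition ball_mean :: "real \<Rightarrow> ('n::finite heis \<Rightarrow> complex) \<Rightarrow> 'n heis set \<Rightarrow> real" where
  "ball_mean q g B =
     ((LINT w:B|lebesgue. norm (g w) powr q) / measure lebesgue B) powr (1 / q)"

definition calderon_eta ::
    "real \<Rightarrow> ('n::finite heis \<Rightarrow> complex) \<Rightarrow> 'n heis \<Rightarrow> ennreal" where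
  "calderon_eta q g z = (SUP r\<in>{0<..}. ennreal (ball_mean q g (heis_ball z r) / r ^ 2))"

text \<open>Elements of \<open>Lq_loc\<close> are functions; the quotient by \<open>\<P>\<^sub>1\<close> is formed
  together with the identification of almost everywhere equal functions.\<close>

definition E1_rel :: "real \<Rightarrow> (('n::finite heis \<Rightarrow> complex) \<times> ('n heis \<Rightarrow> complex)) set" where
  "E1_rel q = {(f, g). f \<in> Lq_loc q \<and> g \<in> Lq_loc q \<and>
     (\<exists>P\<in>heis_polys 1. AE z in lebesgue. f z - g z = P z)}"

definition E1 :: "real \<Rightarrow> ('n::finite heis \<Rightarrow> complex) set set" where
  "E1 q = Lq_loc q // E1_rel q"

definition E1_zero :: "real \<Rightarrow> ('n::finite heis \<Rightarrow> complex) set" where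
  "E1_zero q = E1_rel q `` {\<lambda>_. 0}"

definition calderon_N ::
    "real \<Rightarrow> ('n::finite heis \<Rightarrow> complex) set \<Rightarrow> 'n heis \<Rightarrow> ennreal" where
  "calderon_N q G z = (INF g\<in>G. calderon_eta q g z)"

definition orlicz_calderon_hardy ::
    "(real \<Rightarrow> real) \<Rightarrow> real \<Rightarrow> ('n::finite heis \<Rightarrow> complex) set set" where
  "orlicz_calderon_hardy \<Phi> q = {G \<in> E1 q. calderon_N q G \<in> orlicz_space \<Phi>}"

end

theory Submission
  imports Defs
begin

text \<open>A class \<open>G\<close> that is not zero cannot have a small maximal function at infinity. If \<open>g \<in> G\<close>
  is not almost everywhere equal to an element of \<open>\<P>\<^sub>1\<close>, then it fails to be so already on some
  bounded box \<open>K\<close> (\<open>AE_eq_heis_affine_if_locally\<close>), and since \<open>\<P>\<^sub>1\<close> is finite-dimensional,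
  \<open>g\<close> has a positive \<open>L\<^sup>1(K)\<close>-distance \<open>\<delta>\<close> from \<open>\<P>\<^sub>1\<close>
  (\<open>heis_affine_L1_distance_pos\<close>). So the \<open>q\<close>-th powers of all representatives of \<open>G\<close> have
  integrals over \<open>K\<close> that are bounded below by one positive constant.

  If \<open>z\<close> has homogeneous size at most \<open>R\<close>, with \<open>R\<close> large, then a ball about \<open>z\<close> of radius
  comparable to \<open>R\<close> contains \<open>K\<close> and has measure at most a constant times \<open>R\<^sup>Q\<close>. Averaging over
  it gives \<open>N\<^bsub>q,2\<^esub>(G; z) \<ge> k R\<^bsup>-a\<^esup>\<close> with \<open>a = 2 + Q/q\<close> (\<open>calderon_N_lower_bound\<close>).

  Finally choose an upper type \<open>p\<close> of \<open>\<Phi>\<close> with \<open>p a < Q\<close>. The points of size at most \<open>R\<close> form a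
  set of measure comparable to \<open>R\<^sup>Q\<close>, on which \<open>\<Phi>(N/s) \<ge> \<Phi>(k R\<^bsup>-a\<^esup>/s)\<close>, and
  the upper type condition bounds \<open>\<Phi>(k R\<^bsup>-a\<^esup>/s)\<close> below by a constant times \<open>R\<^bsup>-pa\<^esup>\<close>.
  So \<open>\<integral> \<Phi>(N/s)\<close> exceeds a constant times \<open>R\<^bsup>Q-pa\<^esup>\<close> for all large \<open>R\<close>,
  and is infinite for every \<open>s\<close> (\<open>luxemburg_infinite_if_slow_decay\<close>).\<close>

section \<open>Anisotropic boxes\<close>

text \<open>The closed box \<open>\<bar>x\<^sub>i\<bar> \<le> R\<close>, \<open>\<bar>t\<bar> \<le> R\<^sup>2\<close>: the image of the box with \<open>R = 1\<close> under the
  dilation \<open>(x, t) \<mapsto> (R x, R\<^sup>2 t)\<close>. It is used for \<open>R \<ge> 0\<close>, as a substitute for the Koranyi ball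
  of radius \<open>R\<close> about the origin.\<close>

definition heis_box :: "real \<Rightarrow> 'n::finite heis set" where
  "heis_box R = cbox ((\<chi> i. - R), - (R\<^sup>2)) ((\<chi> i. R), R\<^sup>2)"

lemma mem_heis_box:
  "z \<in> heis_box R \<longleftrightarrow> (\<forall>i. \<bar>fst z $ i\<bar> \<le> R) \<and> \<bar>snd z\<bar> \<le> R\<^sup>2"
  by (cases z) (auto simp: heis_box_def cbox_prod mem_box_cart abs_le_iff minus_le_iff)

lemma heis_box_mono: "0 \<le> R \<Longrightarrow> R \<le> R' \<Longrightarrow> heis_box R \<subseteq> heis_box R'"
  unfolding mem_heis_box subset_iff by (meson order_trans power_mono)

lemma compact_heis_box: "compact (heis_box R)"
  by (simp add: heis_box_def)

lemma lmeasurable_heis_box [simp]: "heis_box R \<in> lmeasurable"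
  by (simp add: heis_box_def)

lemma sets_heis_box [simp, measurable]: "heis_box R \<in> sets lebesgue"
  by (simp add: heis_box_def)

lemma measure_heis_box:
  assumes "0 \<le> R"
  shows "measure lebesgue (heis_box R :: 'n::finite heis set)
    = 2 ^ (2 * CARD('n) + 1) * R ^ (2 * CARD('n) + 2)"
proof -
  have ne: "cbox (\<chi> i. - R) (\<chi> i. R) \<noteq> ({} :: (real ^ ('n + 'n)) set)"
    using assms by (auto simp: set_eq_iff mem_box_cart intro!: exI[of _ 0])
  have "measure lebesgue (heis_box R :: 'n heis set)
      = measure lborel (cbox (\<chi> i. - R) (\<chi> i. R) :: (real ^ ('n + 'n)) set)
        * measure lborel (cbox (- (R\<^sup>2)) (R\<^sup>2))"
    unfolding heis_box_def content_Pair[symmetric] by simp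
  also have "\<dots> = (2 * R) ^ (2 * CARD('n)) * (2 * R\<^sup>2)"
    using content_cbox_cart[OF ne] assms by (simp flip: mult_2)
  also have "\<dots> = 2 ^ (2 * CARD('n) + 1) * R ^ (2 * CARD('n) + 2)"
    by (simp add: power_mult_distrib power_add power2_eq_square)
  finally show ?thesis .
qed

text \<open>The twist in the group law is at most quadratic in the size of the horizontal parts.\<close>

lemma abs_heis_J_form_le:
  fixes x y :: "real ^ ('n::finite + 'n)"
  assumes "\<And>i. \<bar>x $ i\<bar> \<le> a" "\<And>i. \<bar>y $ i\<bar> \<le> b"
  shows "\<bar>x \<bullet> (heis_J *v y)\<bar> \<le> 8 * (real CARD('n))\<^sup>2 * a * b"
proof -
  have J: "\<bar>heis_J $ i $ j\<bar> \<le> 2" for i j :: "'n + 'n"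
    by (auto simp: heis_J_def split: sum.splits)
  have ab: "0 \<le> a" "0 \<le> b"
    using assms abs_ge_zero order_trans by blast+
  have comp: "\<bar>(heis_J *v y) $ i\<bar> \<le> 2 * real CARD('n) * (2 * b)" for i
  proof -
    have "\<bar>(heis_J *v y) $ i\<bar> \<le> (\<Sum>j\<in>UNIV. \<bar>heis_J $ i $ j * y $ j\<bar>)"
      by (simp add: matrix_vector_mult_def sum_abs)
    also have "\<dots> \<le> (\<Sum>j\<in>(UNIV :: ('n + 'n) set). 2 * b)"
      unfolding abs_mult by (intro sum_mono mult_mono J assms) auto
    finally show ?thesis by simp
  qed
  have "\<bar>x \<bullet> (heis_J *v y)\<bar> \<le> (\<Sum>i\<in>UNIV. \<bar>x $ i * (heis_J *v y) $ i\<bar>)"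
    by (simp add: inner_vec_def sum_abs)
  also have "\<dots> \<le> (\<Sum>i\<in>(UNIV :: ('n + 'n) set). a * (2 * real CARD('n) * (2 * b)))"
    unfolding abs_mult by (intro sum_mono mult_mono comp assms ab) auto
  also have "\<dots> = 8 * (real CARD('n))\<^sup>2 * a * b"
    by (simp add: power2_eq_square)
  finally show ?thesis .
qed

lemma koranyi_less_iff:
  assumes "0 < r"
  shows "koranyi z < r \<longleftrightarrow> norm (fst z) ^ 4 + (snd z)\<^sup>2 < r ^ 4"
proof -
  have "root 4 (r ^ 4) = r"
    using assms by (simp add: real_root_power_cancel)
  then show ?thesis
    unfolding koranyi_def by (metis real_root_less_iff zero_less_numeral)
qed

lemma mem_heis_ball:
  assumes "0 < r"
  shows "w \<in> heis_ball z r \<longleftrightarrow>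
    norm (fst w - fst z) ^ 4 + (snd w - snd z - fst z \<bullet> (heis_J *v fst w))\<^sup>2 < r ^ 4"
  using assms by (simp add: heis_ball_def koranyi_less_iff heis_mult_def heis_inv_def)

lemma open_heis_ball:
  fixes z :: "'n::finite heis"
  assumes "0 < r"
  shows "open (heis_ball z r)"
proof -
  have "open {w :: 'n heis. norm (fst w - fst z) ^ 4 + (snd w - snd z - fst z \<bullet> (heis_J *v fst w))\<^sup>2 < r ^ 4}"
    by (intro open_Collect_less continuous_intros matrix_vector_mult_linear_continuous_on
        continuous_on_compose2[OF matrix_vector_mult_linear_continuous_on]) auto
  moreover have "heis_ball z r = {w. norm (fst w - fst z) ^ 4
      + (snd w - snd z - fst z \<bullet> (heis_J *v fst w))\<^sup>2 < r ^ 4}"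
    using assms by (auto simp: mem_heis_ball)
  ultimately show ?thesis by simp
qed

text \<open>The boxes are comparable to Koranyi balls. The constants are not sharp.\<close>

lemma heis_box_subset_heis_ball:
  assumes "0 < R" and "z \<in> heis_box R"
  shows "heis_box R \<subseteq> (heis_ball z (8 * real CARD('n) * R) :: 'n::finite heis set)"
proof
  fix w :: "'n heis"
  assume w: "w \<in> heis_box R"
  let ?n = "real CARD('n)" and ?t = "snd w - snd z - fst z \<bullet> (heis_J *v fst w)"
  have n: "1 \<le> ?n"
    by (simp add: Suc_le_eq)
  have "norm (fst w - fst z) \<le> (\<Sum>i\<in>UNIV. \<bar>(fst w - fst z) $ i\<bar>)"
    by (rule norm_le_l1_cart)
  also have "\<dots> \<le> (\<Sum>i\<in>(UNIV :: ('n + 'n) set). 2 * R)"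
  proof (rule sum_mono)
    fix i :: "'n + 'n"
    have "\<bar>fst w $ i\<bar> \<le> R" "\<bar>fst z $ i\<bar> \<le> R"
      using w assms by (auto simp: mem_heis_box)
    then show "\<bar>(fst w - fst z) $ i\<bar> \<le> 2 * R" by simp
  qed
  finally have x: "norm (fst w - fst z) ^ 4 \<le> (4 * ?n * R) ^ 4"
    by (intro power_mono) auto
  have "\<bar>fst z \<bullet> (heis_J *v fst w)\<bar> \<le> 8 * ?n\<^sup>2 * R * R"
    using w assms by (intro abs_heis_J_form_le) (auto simp: mem_heis_box)
  moreover have "\<bar>snd w\<bar> \<le> R\<^sup>2" "\<bar>snd z\<bar> \<le> R\<^sup>2"
    using w assms by (auto simp: mem_heis_box)
  moreover have "R\<^sup>2 \<le> ?n\<^sup>2 * R\<^sup>2"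
    using n by (simp add: mult_le_cancel_right1)
  ultimately have "\<bar>?t\<bar> \<le> 10 * ?n\<^sup>2 * R\<^sup>2"
    unfolding mult.assoc power2_eq_square[of R, symmetric] by linarith
  then have "?t\<^sup>2 \<le> (10 * ?n\<^sup>2 * R\<^sup>2)\<^sup>2"
    by (metis abs_ge_zero power2_abs power_mono)
  then have "norm (fst w - fst z) ^ 4 + ?t\<^sup>2 \<le> (4 * ?n * R) ^ 4 + (10 * ?n\<^sup>2 * R\<^sup>2)\<^sup>2"
    using x by simp
  also have "\<dots> = 356 * (?n * R) ^ 4"
    by (simp add: power_mult_distrib flip: power_mult)
  also have "\<dots> < (8 * ?n * R) ^ 4"
    using assms by (simp add: power_mult_distrib)
  finally show "w \<in> heis_ball z (8 * ?n * R)"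
    using assms by (simp add: mem_heis_ball)
qed

lemma heis_ball_subset_heis_box:
  assumes "0 < R" and "z \<in> heis_box R"
  shows "heis_ball z (8 * real CARD('n) * R)
    \<subseteq> (heis_box (16 * (1 + real CARD('n))\<^sup>2 * R) :: 'n::finite heis set)"
proof
  let ?n = "real CARD('n)"
  fix w :: "'n heis"
  assume "w \<in> heis_ball z (8 * ?n * R)"
  then have w: "norm (fst w - fst z) ^ 4 + (snd w - snd z - fst z \<bullet> (heis_J *v fst w))\<^sup>2
      < (8 * ?n * R) ^ 4"
    using assms by (simp add: mem_heis_ball)
  have n: "0 < ?n" by simp
  have "norm (fst w - fst z) ^ 4 < (8 * ?n * R) ^ 4"
    using w zero_le_power2[of "snd w - snd z - fst z \<bullet> (heis_J *v fst w)"] by linarith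
  then have d: "norm (fst w - fst z) < 8 * ?n * R"
    by (rule power_less_imp_less_base) (use assms in auto)
  have x: "\<bar>fst w $ i\<bar> \<le> (1 + 8 * ?n) * R" for i
  proof -
    have "\<bar>fst w $ i - fst z $ i\<bar> < 8 * ?n * R"
      using component_le_norm_cart[of "fst w - fst z" i] d by simp
    moreover have "\<bar>fst z $ i\<bar> \<le> R"
      using assms by (simp add: mem_heis_box)
    ultimately show ?thesis by (simp add: algebra_simps)
  qed
  have "(snd w - snd z - fst z \<bullet> (heis_J *v fst w))\<^sup>2 < ((8 * ?n * R)\<^sup>2)\<^sup>2"
  proof -
    have "0 \<le> norm (fst w - fst z) ^ 4" by simp
    with w have "(snd w - snd z - fst z \<bullet> (heis_J *v fst w))\<^sup>2 < (8 * ?n * R) ^ 4"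
      by linarith
    then show ?thesis
      by (simp flip: power_mult)
  qed
  then have "\<bar>snd w - snd z - fst z \<bullet> (heis_J *v fst w)\<bar> < (8 * ?n * R)\<^sup>2"
    by (metis abs_of_nonneg power2_less_imp_less power2_abs zero_le_power2)
  moreover have "\<bar>fst z \<bullet> (heis_J *v fst w)\<bar> \<le> 8 * ?n\<^sup>2 * R * ((1 + 8 * ?n) * R)"
    using x assms by (intro abs_heis_J_form_le) (auto simp: mem_heis_box)
  moreover have "\<bar>snd z\<bar> \<le> R\<^sup>2"
    using assms by (simp add: mem_heis_box)
  ultimately have "\<bar>snd w\<bar> \<le> (64 * ?n\<^sup>2 + 1 + 8 * ?n\<^sup>2 * (1 + 8 * ?n)) * R\<^sup>2"
    by (simp add: power_mult_distrib algebra_simps power2_eq_square)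
  also have "\<dots> \<le> (16 * (1 + ?n)\<^sup>2 * R)\<^sup>2"
  proof -
    have "64 * ?n\<^sup>2 + 1 + 8 * ?n\<^sup>2 * (1 + 8 * ?n) \<le> (16 * (1 + ?n)\<^sup>2)\<^sup>2"
      by (simp add: power2_eq_square algebra_simps)
    then show ?thesis
      unfolding power_mult_distrib[of _ R] by (rule mult_right_mono) simp
  qed
  finally have "\<bar>snd w\<bar> \<le> (16 * (1 + ?n)\<^sup>2 * R)\<^sup>2" .
  moreover have "(1 + 8 * ?n) * R \<le> 16 * (1 + ?n)\<^sup>2 * R"
    using assms by (intro mult_right_mono) (auto simp: power2_eq_square algebra_simps)
  ultimately show "w \<in> heis_box (16 * (1 + ?n)\<^sup>2 * R)"
    using x unfolding mem_heis_box by (meson order_trans)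
qed

section \<open>Polynomials of homogeneous degree at most one\<close>

text \<open>Homogeneous degree at most one excludes \<open>t\<close>, so that such a polynomial is affine in \<open>x\<close>;
  \<open>c\<close> collects its constant term and its linear coefficients.\<close>

definition heis_affine :: "complex \<times> (complex ^ ('n + 'n)) \<Rightarrow> 'n::finite heis \<Rightarrow> complex" where
  "heis_affine c z = fst c + (\<Sum>j\<in>UNIV. snd c $ j * complex_of_real (fst z $ j))"

lemma multi_indices_hom_degree_le_1:
  "{I :: 'n::finite multi_index. hom_degree I \<le> 1}
    = insert (\<lambda>_. 0, 0) (range (\<lambda>j. (\<lambda>i. if i = j then 1 else 0, 0)))" (is "?A = ?B")
proof
  show "?B \<subseteq> ?A"
    by (auto simp: hom_degree_def)
  show "?A \<subseteq> ?B"
  proof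
    fix I :: "'n multi_index"
    assume "I \<in> ?A"
    then have le: "(\<Sum>j\<in>UNIV. fst I j) \<le> 1" and s: "snd I = 0"
      by (auto simp: hom_degree_def)
    show "I \<in> ?B"
    proof (cases "\<forall>j. fst I j = 0")
      case True
      then have "fst I = (\<lambda>_. 0)" by auto
      then show ?thesis using s by (cases I) auto
    next
      case False
      then obtain j where j: "fst I j \<noteq> 0" by auto
      have "(\<Sum>i\<in>UNIV. fst I i) = fst I j + (\<Sum>i\<in>UNIV - {j}. fst I i)"
        by (simp add: sum.remove)
      then have "fst I j = 1" "(\<Sum>i\<in>UNIV - {j}. fst I i) = 0"
        using le j by linarith+
      then have "fst I = (\<lambda>i. if i = j then 1 else 0)"
        by (auto simp: fun_eq_iff)
      then show ?thesis using s by (cases I) auto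
    qed
  qed
qed

lemma heis_polys_1: "heis_polys 1 = range (heis_affine :: _ \<Rightarrow> 'n::finite heis \<Rightarrow> complex)"
proof -
  define e :: "'n + 'n \<Rightarrow> 'n multi_index" where "e j = (\<lambda>i. if i = j then 1 else 0, 0)" for j
  have inj: "inj e"
    by (rule injI) (auto simp: e_def fun_eq_iff split: if_splits)
  have notin: "(\<lambda>_. 0, 0) \<notin> range e"
    by (auto simp: e_def fun_eq_iff) (metis zero_neq_one)
  have mon0: "heis_monomial (\<lambda>_. 0, 0) z = 1" for z :: "'n heis"
    by (simp add: heis_monomial_def)
  have mon1: "heis_monomial (e j) z = fst z $ j" for z :: "'n heis" and j
  proof -
    have "(\<Prod>i\<in>UNIV. (fst z $ i) ^ (if i = j then 1 else 0)) = (\<Prod>i\<in>UNIV. if i = j then fst z $ i else 1)"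
      by (intro prod.cong) auto
    then show ?thesis by (simp add: heis_monomial_def e_def)
  qed
  have sum: "(\<Sum>I | hom_degree I \<le> 1. c I * complex_of_real (heis_monomial I z))
      = heis_affine (c (\<lambda>_. 0, 0), \<chi> j. c (e j)) z" for c and z :: "'n heis"
  proof -
    have "{I :: 'n multi_index. hom_degree I \<le> 1} = insert (\<lambda>_. 0, 0) (range e)"
      unfolding multi_indices_hom_degree_le_1 e_def ..
    then show ?thesis
      using notin inj by (simp add: sum.reindex mon0 mon1 heis_affine_def del: One_nat_def)
  qed
  show ?thesis
  proof (intro equalityI subsetI)
    fix P :: "'n heis \<Rightarrow> complex"
    assume "P \<in> heis_polys 1"
    then show "P \<in> range heis_affine"
      by (auto simp: heis_polys_def sum simp del: One_nat_def)
  next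
    fix P :: "'n heis \<Rightarrow> complex"
    assume "P \<in> range heis_affine"
    then obtain c where P: "P = heis_affine c" by auto
    define d where "d I = (if I = (\<lambda>_. 0, 0) then fst c else snd c $ (THE j. I = e j))" for I
    have "(THE k. e j = e k) = j" for j
      using inj by (auto simp: inj_def)
    moreover have "e j \<noteq> (\<lambda>_. 0, 0)" for j
      using notin by (metis rangeI)
    ultimately have "d (e j) = snd c $ j" for j
      by (simp add: d_def)
    then have "heis_affine c = heis_affine (d (\<lambda>_. 0, 0), \<chi> j. d (e j))"
      by (auto simp: heis_affine_def d_def fun_eq_iff)
    then show "P \<in> heis_polys 1"
      unfolding P heis_polys_def using sum[of d] by (intro CollectI exI[of _ d]) auto
  qed
qed

lemma heis_affine_diff: "heis_affine (c - d) z = heis_affine c z - heis_affine d z"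
  by (simp add: heis_affine_def sum_subtractf algebra_simps)

lemma heis_affine_scaleR: "heis_affine (a *\<^sub>R c) z = a *\<^sub>R heis_affine c z"
  by (simp add: heis_affine_def scaleR_sum_right algebra_simps)

lemma heis_affine_0 [simp]: "heis_affine 0 z = 0"
  by (simp add: heis_affine_def)

lemma continuous_on_heis_affine: "continuous_on S (heis_affine c)"
  unfolding heis_affine_def[abs_def] by (intro continuous_intros)

lemma integrable_heis_affine: "integrable (lebesgue_on (heis_box R)) (heis_affine c)"
  unfolding heis_box_def by (intro continuous_imp_integrable continuous_on_heis_affine)

lemma norm_heis_affine_le:
  fixes z :: "'n::finite heis"
  assumes "z \<in> heis_box R" "0 \<le> R"
  shows "norm (heis_affine c z) \<le> (1 + 2 * real CARD('n) * R) * norm c"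
proof -
  have "norm (heis_affine c z) \<le> norm (fst c) + (\<Sum>j\<in>UNIV. norm (snd c $ j * complex_of_real (fst z $ j)))"
    unfolding heis_affine_def by (intro order_trans[OF norm_triangle_ineq] add_left_mono norm_sum)
  also have "\<dots> \<le> norm c + (\<Sum>j\<in>(UNIV :: ('n + 'n) set). norm c * R)"
  proof (intro add_mono sum_mono)
    show "norm (fst c) \<le> norm c" by (metis norm_fst_le prod.collapse)
    fix j :: "'n + 'n"
    have "norm (snd c $ j) \<le> norm c"
      using Finite_Cartesian_Product.norm_nth_le[of "snd c" j] norm_snd_le[of "snd c" "fst c"] by simp
    moreover have "\<bar>fst z $ j\<bar> \<le> R" using assms by (simp add: mem_heis_box)
    ultimately show "norm (snd c $ j * complex_of_real (fst z $ j)) \<le> norm c * R"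
      unfolding norm_mult by (intro mult_mono) auto
  qed
  also have "\<dots> = (1 + 2 * real CARD('n) * R) * norm c"
    by (simp add: algebra_simps)
  finally show ?thesis .
qed

text \<open>Affine functions that agree almost everywhere on a box about the origin have equal
  coefficients.\<close>

lemma heis_affine_eq_0_AE:
  fixes c :: "complex \<times> (complex ^ ('n::finite + 'n))"
  assumes "0 < R" and ae: "AE z in lebesgue. z \<in> heis_box R \<longrightarrow> heis_affine c z = 0"
  shows "c = 0"
proof -
  let ?B = "box ((\<chi> i. - R), - (R\<^sup>2)) ((\<chi> i. R), R\<^sup>2) :: 'n heis set"
  let ?U = "{z \<in> ?B. heis_affine c z \<noteq> 0}"
  have "?U = ?B \<inter> heis_affine c -` (- {0})"
    by blast
  then have U_open: "open ?U"
    by (simp only: open_Int open_box open_Compl closed_singleton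
        open_vimage[OF _ continuous_on_heis_affine])
  moreover have "negligible ?U"
  proof -
    have "?B \<subseteq> heis_box R"
      unfolding heis_box_def by (rule box_subset_cbox)
    then have "AE z in lebesgue. z \<notin> ?U"
      using ae by (auto elim!: eventually_mono)
    moreover have "?U \<in> sets lebesgue"
      using U_open by (intro sets_completionI_sets) simp
    ultimately show ?thesis
      unfolding negligible_iff_null_sets by (simp only: AE_iff_null_sets)
  qed
  ultimately have U: "?U = {}"
    using open_not_negligible by blast
  have B: "(x, 0) \<in> ?B" if "\<And>i. \<bar>x $ i\<bar> < R" for x
    using that assms by (auto simp: box_prod mem_box_cart abs_less_iff minus_less_iff)
  have zero: "heis_affine c (x, 0) = 0" if "\<And>i. \<bar>x $ i\<bar> < R" for x
    using B[OF that] U by auto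
  have c0: "fst c = 0"
    using zero[of 0] assms by (simp add: heis_affine_def)
  have "snd c $ j = 0" for j
  proof -
    have "heis_affine c (axis j (R / 2), 0) = snd c $ j * complex_of_real (R / 2)"
      by (simp add: heis_affine_def c0 axis_def if_distrib[of complex_of_real] if_distrib[of "(*) _"] cong: if_cong)
    moreover have "heis_affine c (axis j (R / 2), 0) = 0"
      using assms by (intro zero) (auto simp: axis_def)
    ultimately show ?thesis using assms by simp
  qed
  then have "snd c = 0" by (simp add: vec_eq_iff)
  with c0 show ?thesis by (simp add: prod_eq_iff)
qed

section \<open>Local distance to the affine functions\<close>

text \<open>The affine functions found on different boxes have the same coefficients, since all boxes in
  question contain the one with \<open>R = 1\<close>.\<close>

lemma AE_eq_heis_affine_if_locally:
  fixes g :: "'n::finite heis \<Rightarrow> complex"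
  assumes "\<And>R. 0 < R \<Longrightarrow> \<exists>c. AE z in lebesgue. z \<in> heis_box R \<longrightarrow> g z = heis_affine c z"
  shows "\<exists>c. AE z in lebesgue. g z = heis_affine c z"
proof -
  have "\<exists>c. \<forall>k::nat. AE z in lebesgue. z \<in> heis_box (real (Suc k)) \<longrightarrow> g z = heis_affine (c k) z"
    using assms by (intro choice allI) simp
  then obtain c where c: "\<And>k::nat. AE z in lebesgue. z \<in> heis_box (real (Suc k)) \<longrightarrow> g z = heis_affine (c k) z"
    by blast
  have "c k = c 0" for k
  proof -
    have "AE z in lebesgue. z \<in> heis_box 1 \<longrightarrow> heis_affine (c k - c 0) z = 0"
      using c[of k] c[of 0]
    proof eventually_elim
      case (elim z)
      have "heis_box 1 \<subseteq> (heis_box (real (Suc k)) :: 'n heis set)"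
        by (rule heis_box_mono) auto
      then have "heis_affine (c k) z = heis_affine (c 0) z" if "z \<in> heis_box 1"
        using elim that by auto
      then show ?case
        unfolding heis_affine_diff by simp
    qed
    then have "c k - c 0 = 0"
      by (rule heis_affine_eq_0_AE[rotated]) simp
    then show ?thesis by simp
  qed
  then have "AE z in lebesgue. z \<in> heis_box (real (Suc k)) \<longrightarrow> g z = heis_affine (c 0) z" for k
    using c[of k] by (metis (no_types))
  then have "AE z in lebesgue. \<forall>k. z \<in> heis_box (real (Suc k)) \<longrightarrow> g z = heis_affine (c 0) z"
    unfolding AE_all_countable ..
  then have "AE z in lebesgue. g z = heis_affine (c 0) z"
  proof eventually_elim
    case (elim z)
    obtain k :: nat where k: "norm z \<le> real k"
      using real_arch_simple by blast
    have "\<bar>fst z $ i\<bar> \<le> real (Suc k)" for i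
      using component_le_norm_cart[of "fst z" i] norm_fst_le[of "fst z" "snd z"] k by simp
    moreover have "\<bar>snd z\<bar> \<le> real (Suc k)"
      using norm_snd_le[of "snd z" "fst z"] k by simp
    moreover have "real (Suc k) \<le> (real (Suc k))\<^sup>2"
      by (rule self_le_power) auto
    ultimately have "z \<in> heis_box (real (Suc k))"
      unfolding mem_heis_box by (meson order_trans)
    with elim show ?case by blast
  qed
  then show ?thesis ..
qed

text \<open>The distance is positive because it is attained. In the proof, \<open>F h c\<close> is the
  \<open>L\<^sup>1\<close>-distance on the box from \<open>h\<close> to the affine function with coefficients \<open>c\<close>.\<close>

lemma heis_affine_L1_distance_pos:
  fixes g :: "'n::finite heis \<Rightarrow> complex"
  assumes R: "0 < R" and g: "integrable (lebesgue_on (heis_box R)) g"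
    and not_affine: "\<nexists>c. AE z in lebesgue. z \<in> heis_box R \<longrightarrow> g z = heis_affine c z"
  obtains \<delta> where "0 < \<delta>"
    and "\<And>c. \<delta> \<le> (LINT z|lebesgue_on (heis_box R). norm (g z - heis_affine c z))"
proof -
  let ?M = "lebesgue_on (heis_box R) :: 'n heis measure"
  interpret finite_measure ?M
    by (rule finite_measure_lebesgue_on) simp
  define F where "F h c = (LINT z|?M. norm (h z - heis_affine c z))"
    for h :: "'n heis \<Rightarrow> complex" and c
  have int: "integrable ?M (\<lambda>z. norm (h z - heis_affine c z))" if "integrable ?M h" for h c
    by (intro integrable_norm Bochner_Integration.integrable_diff that integrable_heis_affine)
  have F_nonneg: "0 \<le> F h c" for h c
    by (simp add: F_def)
  have F_zero: "AE z in lebesgue. z \<in> heis_box R \<longrightarrow> h z = heis_affine c z"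
    if "integrable ?M h" "F h c = 0" for h c
  proof -
    have "AE z in ?M. norm (h z - heis_affine c z) = 0"
      using that(2) integral_nonneg_eq_0_iff_AE[OF int[OF that(1)]] by (simp add: F_def)
    then have "AE z in lebesgue. z \<in> heis_box R \<longrightarrow> norm (h z - heis_affine c z) = 0"
      by (subst (asm) AE_restrict_space_iff) auto
    then show ?thesis
      by (rule eventually_mono) simp
  qed
  have F_triangle: "F h c \<le> F h d + F (\<lambda>_. 0) (c - d)" if "integrable ?M h" for h c d
  proof -
    have "F h c \<le> (LINT z|?M. norm (h z - heis_affine d z) + norm (0 - heis_affine (c - d) z))"
      unfolding F_def
    proof (rule integral_mono)
      fix z
      have "h z - heis_affine c z = (h z - heis_affine d z) + (0 - heis_affine (c - d) z)"
        by (simp add: heis_affine_diff)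
      then show "norm (h z - heis_affine c z)
          \<le> norm (h z - heis_affine d z) + norm (0 - heis_affine (c - d) z)"
        by (metis norm_triangle_ineq)
    qed (intro int Bochner_Integration.integrable_add that integrable_zero)+
    also have "\<dots> = F h d + F (\<lambda>_. 0) (c - d)"
      unfolding F_def by (intro Bochner_Integration.integral_add int that integrable_zero)
    finally show ?thesis .
  qed
  define L where "L = (1 + 2 * real CARD('n) * R) * measure ?M (space ?M)"
  have L: "0 \<le> L" using R by (simp add: L_def)
  have F0_le: "F (\<lambda>_. 0) c \<le> L * norm c" for c
  proof -
    have "F (\<lambda>_. 0) c \<le> (LINT z|?M. (1 + 2 * real CARD('n) * R) * norm c)"
      unfolding F_def using R
      by (intro integral_mono int) (auto intro!: norm_heis_affine_le)
    then show ?thesis by (simp add: L_def mult_ac)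
  qed
  have cont: "continuous_on S (F h)" if "integrable ?M h" for h S
  proof -
    have "L-lipschitz_on S (F h)"
    proof (rule lipschitz_onI)
      fix c d
      have "F h c \<le> F h d + L * norm (c - d)" "F h d \<le> F h c + L * norm (d - c)"
        using F_triangle[OF that] F0_le order_trans add_left_mono by meson+
      then show "dist (F h c) (F h d) \<le> L * dist c d"
        by (simp add: dist_norm norm_minus_commute abs_le_iff)
    qed (rule L)
    then show ?thesis by (rule lipschitz_on_continuous_on)
  qed
  \<comment> \<open>\<open>F 0\<close> is a norm on the finite-dimensional space of coefficients.\<close>
  obtain \<kappa> where \<kappa>: "0 < \<kappa>" "\<And>c. \<kappa> * norm c \<le> F (\<lambda>_. 0) c"
  proof -
    have "(1, 0) \<in> sphere (0 :: complex \<times> (complex ^ ('n + 'n))) 1"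
      by (simp add: norm_Pair)
    then have "\<exists>e\<in>sphere 0 1. \<forall>c\<in>sphere 0 1. F (\<lambda>_. 0) e \<le> F (\<lambda>_. 0) c"
      by (intro continuous_attains_inf cont) auto
    then obtain e where e: "norm e = 1" "\<And>c. norm c = 1 \<Longrightarrow> F (\<lambda>_. 0) e \<le> F (\<lambda>_. 0) c"
      by auto
    show ?thesis
    proof
      have "F (\<lambda>_. 0) e \<noteq> 0"
      proof
        assume "F (\<lambda>_. 0) e = 0"
        then have "e = 0"
          using F_zero[of "\<lambda>_. 0" e]
          by (intro heis_affine_eq_0_AE[OF R]) (auto elim!: eventually_mono)
        with e(1) show False by simp
      qed
      with F_nonneg show "0 < F (\<lambda>_. 0) e"
        by (metis less_eq_real_def)
      fix c
      show "F (\<lambda>_. 0) e * norm c \<le> F (\<lambda>_. 0) c"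
      proof (cases "c = 0")
        case False
        have "F (\<lambda>_. 0) c = F (\<lambda>_. 0) (norm c *\<^sub>R (inverse (norm c) *\<^sub>R c))"
          using False by simp
        also have "\<dots> = norm c * F (\<lambda>_. 0) (inverse (norm c) *\<^sub>R c)"
          unfolding F_def heis_affine_scaleR[of "norm c"] by simp
        also have "\<dots> \<ge> norm c * F (\<lambda>_. 0) e"
          using False by (intro mult_left_mono e(2)) auto
        finally show ?thesis by (simp add: mult.commute)
      qed (simp add: F_nonneg)
    qed
  qed
  \<comment> \<open>Hence \<open>F g\<close> is coercive, and its minimum over a large ball is a global one.\<close>
  have coercive: "\<kappa> * norm c \<le> F g c + F g 0" for c
  proof -
    have "(LINT z|?M. norm (0 - heis_affine c z))
        \<le> (LINT z|?M. norm (g z - heis_affine c z) + norm (g z - heis_affine 0 z))"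
    proof (rule integral_mono)
      fix z
      show "norm (0 - heis_affine c z) \<le> norm (g z - heis_affine c z) + norm (g z - heis_affine 0 z)"
        using norm_triangle_ineq4[of "g z - heis_affine c z" "g z"] by simp
    qed (intro int Bochner_Integration.integrable_add g integrable_zero)+
    also have "\<dots> = F g c + F g 0"
      unfolding F_def by (intro Bochner_Integration.integral_add int g)
    finally show ?thesis
      using \<kappa>(2)[of c] by (simp add: F_def)
  qed
  have "0 \<le> 2 * F g 0 / \<kappa>"
    using \<kappa>(1) F_nonneg[of g 0] by simp
  then have "\<exists>m\<in>cball 0 (2 * F g 0 / \<kappa>). \<forall>c\<in>cball 0 (2 * F g 0 / \<kappa>). F g m \<le> F g c"
    by (intro continuous_attains_inf cont g) auto
  then obtain m where m: "\<And>c. norm c \<le> 2 * F g 0 / \<kappa> \<Longrightarrow> F g m \<le> F g c"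
    unfolding Ball_def mem_cball_0 by blast
  show ?thesis
  proof
    show "0 < F g m"
      using F_zero[OF g, of m] not_affine F_nonneg[of g m] by (metis less_le)
    fix c
    show "F g m \<le> (LINT z|?M. norm (g z - heis_affine c z))"
      unfolding F_def[symmetric]
    proof (cases "norm c \<le> 2 * F g 0 / \<kappa>")
      case False
      then have "2 * F g 0 \<le> \<kappa> * norm c"
        using \<kappa>(1) by (simp add: field_simps)
      with coercive[of c] have "F g 0 \<le> F g c" by linarith
      moreover have "F g m \<le> F g 0"
        using \<kappa>(1) F_nonneg[of g 0] by (intro m) auto
      ultimately show "F g m \<le> F g c" by simp
    qed (rule m)
  qed
qed

text \<open>A lower bound for the mean of \<open>u\<close> gives one for the mean of \<open>u\<^sup>q\<close>, because
  \<open>u \<le> \<epsilon> + \<epsilon>\<^bsup>1 - q\<^esup> u\<^sup>q\<close> pointwise.\<close>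

lemma (in finite_measure) integral_powr_ge_of_integral_ge:
  fixes u :: "'a \<Rightarrow> real"
  assumes q: "1 \<le> q" and u: "integrable M u" "\<And>x. 0 \<le> u x" "integrable M (\<lambda>x. u x powr q)"
    and \<epsilon>: "0 < \<epsilon>" and ge: "2 * \<epsilon> * measure M (space M) \<le> (LINT x|M. u x)"
  shows "\<epsilon> powr q * measure M (space M) \<le> (LINT x|M. u x powr q)"
proof -
  have "u x \<le> \<epsilon> + \<epsilon> powr (1 - q) * u x powr q" for x
  proof (cases "u x \<le> \<epsilon>")
    case False
    then have "\<epsilon> powr (q - 1) \<le> u x powr (q - 1)"
      using q \<epsilon> by (intro powr_mono2) auto
    then have "\<epsilon> powr (1 - q) * \<epsilon> powr (q - 1) * u x \<le> \<epsilon> powr (1 - q) * u x powr (q - 1) * u x"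
      using u(2)[of x] by (intro mult_right_mono mult_left_mono) auto
    moreover have "\<epsilon> powr (1 - q) * \<epsilon> powr (q - 1) = 1"
      using \<epsilon> by (simp flip: powr_add)
    moreover have "u x powr (q - 1) * u x = u x powr q"
      using False \<epsilon> by (simp add: powr_diff)
    ultimately show ?thesis using \<epsilon> by (simp add: mult.assoc)
  next
    case True
    moreover have "0 \<le> \<epsilon> powr (1 - q) * u x powr q" by simp
    ultimately show ?thesis by linarith
  qed
  then have "(LINT x|M. u x) \<le> (LINT x|M. \<epsilon> + \<epsilon> powr (1 - q) * u x powr q)"
    using u by (intro integral_mono) auto
  also have "\<dots> = \<epsilon> * measure M (space M) + \<epsilon> powr (1 - q) * (LINT x|M. u x powr q)"
    using u by simp
  finally have "\<epsilon> * measure M (space M) \<le> \<epsilon> powr (1 - q) * (LINT x|M. u x powr q)"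
    using ge by simp
  then have "\<epsilon> powr (q - 1) * (\<epsilon> * measure M (space M))
      \<le> \<epsilon> powr (q - 1) * (\<epsilon> powr (1 - q) * (LINT x|M. u x powr q))"
    by (intro mult_left_mono) auto
  moreover have "\<epsilon> powr (q - 1) * \<epsilon> = \<epsilon> powr q" "\<epsilon> powr (q - 1) * \<epsilon> powr (1 - q) = 1"
    using \<epsilon> by (simp_all add: powr_diff)
  ultimately show ?thesis by (simp flip: mult.assoc)
qed

section \<open>Lower bound for the maximal function\<close>

lemma Lq_loc_integrable_powr:
  assumes "g \<in> Lq_loc q"
  shows "integrable (lebesgue_on (heis_box R)) (\<lambda>w. norm (g w) powr q)"
  using assms compact_heis_box[of R] unfolding Lq_loc_def
  by (subst set_integrable_eq[symmetric]) auto

lemma Lq_loc_integrable: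
  assumes "1 \<le> q" and "g \<in> Lq_loc q"
  shows "integrable (lebesgue_on (heis_box R)) g"
proof (rule Bochner_Integration.integrable_bound)
  let ?M = "lebesgue_on (heis_box R)"
  interpret finite_measure ?M
    by (rule finite_measure_lebesgue_on) simp
  show "integrable ?M (\<lambda>w. 1 + norm (g w) powr q)"
    by (intro Bochner_Integration.integrable_add Lq_loc_integrable_powr assms integrable_const)
  show "g \<in> borel_measurable ?M"
    using assms by (intro measurable_restrict_space1) (simp add: Lq_loc_def)
  have "norm (g w) \<le> 1 + norm (g w) powr q" for w
  proof (cases "norm (g w) \<le> 1")
    case False
    then have "norm (g w) powr 1 \<le> norm (g w) powr q"
      using assms by (intro powr_mono) auto
    then show ?thesis using False by simp
  qed (simp add: add_increasing2)
  then show "AE w in ?M. norm (g w) \<le> norm (1 + norm (g w) powr q)"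
    by (intro AE_I2) (smt (verit) real_norm_def powr_ge_zero)
qed

lemma ball_mean_lower_bound:
  fixes g :: "'n::finite heis \<Rightarrow> complex"
  assumes "1 < q" and g: "g \<in> Lq_loc q"
    and R: "1 \<le> R\<^sub>0" "R\<^sub>0 \<le> R" and z: "z \<in> heis_box R" and "0 < \<epsilon>"
    and ge: "\<epsilon> \<le> (LINT w|lebesgue_on (heis_box R\<^sub>0). norm (g w) powr q)"
  shows "(\<epsilon> / (2 ^ (2 * CARD('n) + 1) * (16 * (1 + real CARD('n))\<^sup>2 * R) ^ (2 * CARD('n) + 2))) powr (1 / q)
    \<le> ball_mean q g (heis_ball z (8 * real CARD('n) * R))"
proof -
  define B where "B = heis_ball z (8 * real CARD('n) * R)"
  let ?R' = "16 * (1 + real CARD('n))\<^sup>2 * R"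
  have "open B"
    unfolding B_def using R by (intro open_heis_ball) simp
  then have B_sets: "B \<in> sets lebesgue"
    by (intro sets_completionI_sets) simp
  have sub: "heis_box R\<^sub>0 \<subseteq> B"
    using heis_box_mono[of R\<^sub>0 R] heis_box_subset_heis_ball[OF _ z] R by (auto simp: B_def)
  have sup: "B \<subseteq> heis_box ?R'"
    unfolding B_def using R by (intro heis_ball_subset_heis_box z) simp
  have "measure lebesgue (heis_box R\<^sub>0 :: 'n heis set) \<le> measure lebesgue B"
    using sub sup B_sets by (intro measure_mono_fmeasurable fmeasurableI2[OF lmeasurable_heis_box]) auto
  moreover have "0 < measure lebesgue (heis_box R\<^sub>0 :: 'n heis set)"
    using R by (subst measure_heis_box) auto
  ultimately have B_pos: "0 < measure lebesgue B" by linarith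
  have B_le: "measure lebesgue B \<le> 2 ^ (2 * CARD('n) + 1) * ?R' ^ (2 * CARD('n) + 2)"
    using measure_mono_fmeasurable[OF sup B_sets] measure_heis_box[of ?R', where 'n = 'n] R by simp
  have int: "set_integrable lebesgue A (\<lambda>w. norm (g w) powr q)"
    if "A \<in> sets lebesgue" "A \<subseteq> heis_box ?R'" for A
  proof (rule set_integrable_subset[OF _ that])
    show "set_integrable lebesgue (heis_box ?R') (\<lambda>w. norm (g w) powr q)"
      using g by (simp add: Lq_loc_def compact_heis_box)
  qed
  have "\<epsilon> \<le> (LINT w:heis_box R\<^sub>0|lebesgue. norm (g w) powr q)"
    using ge unfolding set_lebesgue_integral_def by (subst (asm) integral_restrict_space) auto
  also have "\<dots> \<le> (LINT w:B|lebesgue. norm (g w) powr q)"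
    unfolding set_lebesgue_integral_def using sub sup B_sets
    by (intro integral_mono int[unfolded set_integrable_def]) (auto simp: indicator_def)
  finally have "\<epsilon> \<le> (LINT w:B|lebesgue. norm (g w) powr q)" .
  then have "\<epsilon> / (2 ^ (2 * CARD('n) + 1) * ?R' ^ (2 * CARD('n) + 2))
      \<le> (LINT w:B|lebesgue. norm (g w) powr q) / measure lebesgue B"
    using B_pos B_le \<open>0 < \<epsilon>\<close> by (intro frac_le) auto
  then show ?thesis
    unfolding ball_mean_def B_def[symmetric] using assms by (intro powr_mono2) auto
qed

text \<open>The case \<open>R \<approx> \<rho>(z)\<close> is the bound \<open>N(z) \<ge> k' \<rho>(z)\<^bsup>-(2 + Q/q)\<^esup>\<close> for large \<open>\<rho>(z)\<close>;
  the form with a free parameter \<open>R\<close> avoids computing with \<open>\<rho>\<close>.\<close>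

lemma calderon_N_lower_bound:
  fixes g :: "'n::finite heis \<Rightarrow> complex"
  assumes Q: "Q = 2 * real CARD('n) + 2" and q: "1 < q" and g: "g \<in> Lq_loc q"
    and not_affine: "\<nexists>c. AE z in lebesgue. g z = heis_affine c z"
  obtains k R\<^sub>0 where "0 < k" "1 \<le> R\<^sub>0"
    and "\<And>R z. R\<^sub>0 \<le> R \<Longrightarrow> z \<in> heis_box R \<Longrightarrow>
      ennreal (k * R powr - (2 + Q / q)) \<le> calderon_N q (E1_rel q `` {g}) z"
proof -
  let ?n = "real CARD('n)"
  obtain R\<^sub>1 where "0 < R\<^sub>1"
    and R1: "\<nexists>c. AE z in lebesgue. z \<in> heis_box R\<^sub>1 \<longrightarrow> g z = heis_affine c z"
    using AE_eq_heis_affine_if_locally[of g] not_affine by blast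
  define R\<^sub>0 where "R\<^sub>0 = max 1 R\<^sub>1"
  have R0: "1 \<le> R\<^sub>0" "0 < R\<^sub>0" by (auto simp: R\<^sub>0_def)
  have "(heis_box R\<^sub>1 :: 'n heis set) \<subseteq> heis_box R\<^sub>0"
    using \<open>0 < R\<^sub>1\<close> by (intro heis_box_mono) (auto simp: R\<^sub>0_def)
  then have "AE z in lebesgue. z \<in> heis_box R\<^sub>1 \<longrightarrow> g z = heis_affine c z"
    if "AE z in lebesgue. z \<in> heis_box R\<^sub>0 \<longrightarrow> g z = heis_affine c z" for c
    using that by (rule_tac eventually_mono) auto
  with R1 have "\<nexists>c. AE z in lebesgue. z \<in> heis_box R\<^sub>0 \<longrightarrow> g z = heis_affine c z"
    by blast
  then obtain \<delta> where \<delta>: "0 < \<delta>"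
    "\<And>c. \<delta> \<le> (LINT z|lebesgue_on (heis_box R\<^sub>0). norm (g z - heis_affine c z))"
    using heis_affine_L1_distance_pos[OF R0(2) Lq_loc_integrable[OF less_imp_le[OF q] g]] by blast
  let ?M = "lebesgue_on (heis_box R\<^sub>0) :: 'n heis measure"
  define V where "V = measure ?M (space ?M)"
  have "V = measure lebesgue (heis_box R\<^sub>0 :: 'n heis set)"
    by (simp add: V_def measure_restrict_space)
  then have V: "0 < V"
    using R0 by (simp add: measure_heis_box)
  define \<epsilon> where "\<epsilon> = (\<delta> / (2 * V)) powr q * V"
  have \<epsilon>: "0 < \<epsilon>" using \<delta>(1) V by (simp add: \<epsilon>_def)
  have ge: "\<epsilon> \<le> (LINT w|?M. norm (h w) powr q)"
    if h: "(g, h) \<in> E1_rel q" for h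
  proof -
    obtain c where "h \<in> Lq_loc q" and c: "AE z in lebesgue. g z - h z = heis_affine c z"
      using h unfolding E1_rel_def heis_polys_1 by auto
    interpret finite_measure ?M
      by (rule finite_measure_lebesgue_on) simp
    have "AE z in ?M. norm (g z - heis_affine c z) = norm (h z)"
      using c by (subst AE_restrict_space_iff) (auto elim!: eventually_mono simp: algebra_simps)
    then have "(LINT z|?M. norm (g z - heis_affine c z)) = (LINT z|?M. norm (h z))"
      using Lq_loc_integrable[OF less_imp_le[OF q]] g \<open>h \<in> Lq_loc q\<close>
      by (intro integral_cong_AE borel_measurable_integrable integrable_norm
          Bochner_Integration.integrable_diff integrable_heis_affine) auto
    then have "2 * (\<delta> / (2 * V)) * V \<le> (LINT z|?M. norm (h z))"
      using \<delta>(2)[of c] V by simp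
    then show ?thesis
      unfolding \<epsilon>_def V_def using q \<delta>(1) V \<open>h \<in> Lq_loc q\<close>
      by (intro integral_powr_ge_of_integral_ge integrable_norm Lq_loc_integrable
          Lq_loc_integrable_powr) (auto simp: V_def)
  qed
  define W where "W = 2 ^ (2 * CARD('n) + 1) * (16 * (1 + ?n)\<^sup>2) ^ (2 * CARD('n) + 2)"
  have W: "0 < W" by (simp add: W_def)
  define k where "k = (\<epsilon> / W) powr (1 / q) / (8 * ?n)\<^sup>2"
  have "0 < k" using \<epsilon> W by (simp add: k_def)
  moreover have "ennreal (k * R powr - (2 + Q / q)) \<le> calderon_N q (E1_rel q `` {g}) z"
    if R: "R\<^sub>0 \<le> R" and z: "z \<in> heis_box R" for R z
    unfolding calderon_N_def
  proof (rule INF_greatest)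
    fix h
    assume "h \<in> E1_rel q `` {g}"
    then have h: "(g, h) \<in> E1_rel q" by simp
    have "0 < R" using R R0 by simp
    let ?r = "8 * ?n * R"
    have "Q = real (2 * CARD('n) + 2)" by (simp add: Q)
    then have "R ^ (2 * CARD('n) + 2) = R powr Q"
      using powr_realpow[OF \<open>0 < R\<close>] by metis
    then have "2 ^ (2 * CARD('n) + 1) * (16 * (1 + ?n)\<^sup>2 * R) ^ (2 * CARD('n) + 2) = W * R powr Q"
      unfolding W_def power_mult_distrib[of _ R] by simp
    moreover have "(\<epsilon> / (2 ^ (2 * CARD('n) + 1) * (16 * (1 + ?n)\<^sup>2 * R) ^ (2 * CARD('n) + 2))) powr (1 / q)
        \<le> ball_mean q h (heis_ball z ?r)"
      using h by (intro ball_mean_lower_bound[OF q _ R0(1) R z \<epsilon> ge]) (auto simp: E1_rel_def)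
    ultimately have mean: "(\<epsilon> / (W * R powr Q)) powr (1 / q) \<le> ball_mean q h (heis_ball z ?r)"
      by simp
    have "(\<epsilon> / (W * R powr Q)) powr (1 / q) = (\<epsilon> / W) powr (1 / q) * R powr - (Q / q)"
    proof -
      have "\<epsilon> / (W * R powr Q) = \<epsilon> / W * R powr - Q"
        by (simp add: powr_minus divide_simps)
      then show ?thesis
        using \<epsilon> W powr_mult[of "\<epsilon> / W" "R powr - Q" "1 / q"] by (simp add: powr_powr)
    qed
    moreover have "R powr - (2 + Q / q) = R powr - (Q / q) / R\<^sup>2"
    proof -
      have "- (2 + Q / q) = - (Q / q) - 2" by simp
      then have "R powr - (2 + Q / q) = R powr - (Q / q) / R powr 2" by (simp only: powr_diff)
      then show ?thesis using \<open>0 < R\<close> by simp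
    qed
    ultimately have "k * R powr - (2 + Q / q) = (\<epsilon> / (W * R powr Q)) powr (1 / q) / ?r\<^sup>2"
      by (simp only: k_def power_mult_distrib) simp
    with mean have "k * R powr - (2 + Q / q) \<le> ball_mean q h (heis_ball z ?r) / ?r\<^sup>2"
      by (simp only: divide_right_mono zero_le_power2)
    then have "ennreal (k * R powr - (2 + Q / q)) \<le> ennreal (ball_mean q h (heis_ball z ?r) / ?r\<^sup>2)"
      by (rule ennreal_leI)
    also have "\<dots> \<le> calderon_eta q h z"
      unfolding calderon_eta_def using \<open>0 < R\<close> by (intro SUP_upper) simp
    finally show "ennreal (k * R powr - (2 + Q / q)) \<le> calderon_eta q h z" .
  qed
  ultimately show ?thesis using that R0(1) by blast
qed

section \<open>Slowly decaying functions are not in the Orlicz space\<close>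

lemma luxemburg_infinite_if_slow_decay:
  fixes u :: "'n::finite heis \<Rightarrow> ennreal" and a k p R\<^sub>0 :: real
  assumes Phi: "orlicz_function TYPE('n) \<Phi>" and type: "positive_upper_type \<Phi> p"
    and a: "0 < a" "p * a < 2 * real CARD('n) + 2" and k: "0 < k" and R0: "1 \<le> R\<^sub>0"
    and ge: "\<And>R z. R\<^sub>0 \<le> R \<Longrightarrow> z \<in> heis_box R \<Longrightarrow> ennreal (k * R powr - a) \<le> u z"
  shows "luxemburg \<Phi> u = \<infinity>"
proof (rule ccontr)
  let ?Q = "2 * real CARD('n) + 2"
  assume "luxemburg \<Phi> u \<noteq> \<infinity>"
  then have "luxemburg \<Phi> u < \<infinity>" by (simp add: less_top)
  then obtain s where s: "0 < s" and le: "(\<integral>\<^sup>+ z. orlicz_ext \<Phi> (u z / ennreal s) \<partial>lebesgue) \<le> 1"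
    unfolding luxemburg_def INF_less_iff by blast
  from Phi have mono: "mono_on {0..} \<Phi>" and nonneg: "\<And>t. 0 \<le> t \<Longrightarrow> 0 \<le> \<Phi> t"
    and pos: "\<And>t. 0 < t \<Longrightarrow> 0 < \<Phi> t"
    by (auto simp: orlicz_function_def)
  from type obtain C where p: "0 < p" and C: "0 < C"
    and upper: "\<And>t r. 0 < t \<Longrightarrow> 1 \<le> r \<Longrightarrow> \<Phi> (r * t) \<le> C * r powr p * \<Phi> t"
    by (auto simp: positive_upper_type_def)
  have bound: "\<Phi> (k / s) * R powr (?Q - p * a) \<le> C" if R: "R\<^sub>0 \<le> R" for R
  proof -
    have "1 \<le> R" using R R0 by simp
    define t where "t = k * R powr - a / s"
    have t: "0 < t" using k s \<open>1 \<le> R\<close> by (simp add: t_def)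
    have Phi_le: "ennreal (\<Phi> t) \<le> orlicz_ext \<Phi> (u z / ennreal s)" if "z \<in> heis_box R" for z
    proof (cases "u z / ennreal s = \<infinity>")
      case False
      have "ennreal t = ennreal (k * R powr - a) / ennreal s"
        unfolding t_def using k s by (simp add: divide_ennreal)
      also have "\<dots> \<le> u z / ennreal s"
        by (intro divide_right_mono_ennreal ge R that)
      finally have "enn2real (ennreal t) \<le> enn2real (u z / ennreal s)"
        using False by (intro enn2real_mono) (auto simp: less_top)
      then have "t \<le> enn2real (u z / ennreal s)"
        using t by simp
      then have "\<Phi> t \<le> \<Phi> (enn2real (u z / ennreal s))"
        using t by (intro mono_onD[OF mono]) auto
      then show ?thesis
        using False by (simp add: orlicz_ext_def ennreal_leI)
    qed (simp add: orlicz_ext_def)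
    define V where "V = measure lebesgue (heis_box R :: 'n heis set)"
    have V: "V = 2 ^ (2 * CARD('n) + 1) * R powr ?Q"
    proof -
      have "?Q = real (2 * CARD('n) + 2)" by simp
      then have "R powr ?Q = R ^ (2 * CARD('n) + 2)"
        using powr_realpow[of R "2 * CARD('n) + 2"] \<open>1 \<le> R\<close> by (metis less_le_trans zero_less_one)
      then show ?thesis
        using measure_heis_box[of R, where 'n = 'n] \<open>1 \<le> R\<close> unfolding V_def by simp
    qed
    have "ennreal (\<Phi> t * V) = (\<integral>\<^sup>+ z. ennreal (\<Phi> t) * indicator (heis_box R :: 'n heis set) z \<partial>lebesgue)"
      using t nonneg by (subst nn_integral_cmult_indicator)
        (auto simp: V_def emeasure_eq_measure2 ennreal_mult)
    also have "\<dots> \<le> (\<integral>\<^sup>+ z. orlicz_ext \<Phi> (u z / ennreal s) \<partial>lebesgue)"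
      using Phi_le by (intro nn_integral_mono) (auto simp: indicator_def)
    finally have "ennreal (\<Phi> t * V) \<le> 1" using le by (rule order_trans)
    then have "\<Phi> t * V \<le> 1" by simp
    moreover have "R powr ?Q \<le> V"
      unfolding V using one_le_power[of "2 :: real" "2 * CARD('n) + 1"]
      by (simp only: mult_le_cancel_right1) simp
    ultimately have small: "\<Phi> t * R powr ?Q \<le> 1"
      using nonneg[of t] t by (meson less_imp_le mult_left_mono order_trans)
    have "k / s = R powr a * t"
      using \<open>1 \<le> R\<close> by (simp add: t_def powr_minus field_simps)
    then have "\<Phi> (k / s) \<le> C * (R powr a) powr p * \<Phi> t"
      using upper[OF t, of "R powr a"] \<open>1 \<le> R\<close> a by (simp add: ge_one_powr_ge_zero)
    then have "\<Phi> (k / s) * R powr (?Q - p * a)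
        \<le> C * R powr (p * a) * \<Phi> t * R powr (?Q - p * a)"
      by (intro mult_right_mono) (auto simp: powr_powr mult.commute)
    also have "\<dots> = C * (\<Phi> t * R powr ?Q)"
      using \<open>1 \<le> R\<close> by (simp add: powr_diff)
    also have "\<dots> \<le> C" using small C by (simp add: mult_left_le)
    finally show ?thesis .
  qed
  \<comment> \<open>The exponent of \<open>R\<close> in \<open>bound\<close> is positive, so \<open>bound\<close> fails for large \<open>R\<close>.\<close>
  define x where "x = C / \<Phi> (k / s) + 1"
  have x: "0 < x"
    using C pos[of "k / s"] k s by (simp add: x_def add_pos_pos)
  define R where "R = max R\<^sub>0 (x powr (1 / (?Q - p * a)))"
  have "x = (x powr (1 / (?Q - p * a))) powr (?Q - p * a)"
    using x a by (simp add: powr_powr)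
  also have "\<dots> \<le> R powr (?Q - p * a)"
    using a by (intro powr_mono2) (auto simp: R_def)
  finally have "\<Phi> (k / s) * x \<le> \<Phi> (k / s) * R powr (?Q - p * a)"
    using pos[of "k / s"] k s by (intro mult_left_mono) auto
  also have "\<dots> \<le> C"
    by (rule bound) (simp add: R_def)
  finally show False
    using pos[of "k / s"] k s by (simp add: x_def field_simps)
qed

section \<open>Triviality of the space\<close>

lemma E1_rel_image_eq_E1_zero:
  assumes g: "g \<in> Lq_loc q" and c: "AE z in lebesgue. g z = heis_affine c z"
  shows "E1_rel q `` {g} = E1_zero q"
proof -
  have zero: "(\<lambda>_. 0) \<in> Lq_loc q"
    by (simp add: Lq_loc_def set_integrable_def)
  have "(\<exists>d. AE z in lebesgue. g z - h z = heis_affine d z)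
      \<longleftrightarrow> (\<exists>d. AE z in lebesgue. 0 - h z = heis_affine d z)" for h
  proof
    assume "\<exists>d. AE z in lebesgue. g z - h z = heis_affine d z"
    then obtain d where "AE z in lebesgue. g z - h z = heis_affine d z" ..
    with c have "AE z in lebesgue. 0 - h z = heis_affine (d - c) z"
      by eventually_elim (simp add: heis_affine_diff algebra_simps)
    then show "\<exists>d. AE z in lebesgue. 0 - h z = heis_affine d z" ..
  next
    assume "\<exists>d. AE z in lebesgue. 0 - h z = heis_affine d z"
    then obtain d where "AE z in lebesgue. 0 - h z = heis_affine d z" ..
    with c have "AE z in lebesgue. g z - h z = heis_affine (c - (0 - d)) z"
    proof eventually_elim
      case (elim z)
      show ?case
        unfolding heis_affine_diff heis_affine_0 elim(1) elim(2)[symmetric] by simp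
    qed
    then show "\<exists>d. AE z in lebesgue. g z - h z = heis_affine d z" ..
  qed
  then show ?thesis
    using g zero unfolding E1_zero_def E1_rel_def heis_polys_1 by auto
qed

lemma E1_zero_in_orlicz_calderon_hardy:
  assumes "orlicz_function TYPE('n::finite) \<Phi>"
  shows "(E1_zero q :: ('n heis \<Rightarrow> complex) set) \<in> orlicz_calderon_hardy \<Phi> q"
proof -
  have zero: "(\<lambda>_. 0) \<in> (Lq_loc q :: ('n heis \<Rightarrow> complex) set)"
    by (simp add: Lq_loc_def set_integrable_def)
  have "AE z :: 'n heis in lebesgue. 0 - 0 = heis_affine 0 z"
    by simp
  then have "(\<lambda>_. 0) \<in> (E1_zero q :: ('n heis \<Rightarrow> complex) set)"
    using zero unfolding E1_zero_def E1_rel_def heis_polys_1 by blast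
  moreover have "calderon_eta q (\<lambda>_. 0 :: complex) z = 0" for z :: "'n heis"
    by (simp add: calderon_eta_def ball_mean_def set_lebesgue_integral_def)
  ultimately have "calderon_N q (E1_zero q) z \<le> 0" for z :: "'n heis"
    unfolding calderon_N_def by (metis INF_lower)
  then have N: "calderon_N q (E1_zero q) = (\<lambda>_ :: 'n heis. 0)"
    by (simp add: fun_eq_iff)
  have "luxemburg \<Phi> (\<lambda>_ :: 'n heis. 0) \<le> ennreal 1"
    unfolding luxemburg_def using assms
    by (intro INF_lower) (auto simp: orlicz_ext_def orlicz_function_def)
  then have "calderon_N q (E1_zero q) \<in> (orlicz_space \<Phi> :: ('n heis \<Rightarrow> ennreal) set)"
    unfolding N orlicz_space_def by (auto simp: less_top[symmetric] top_unique)
  moreover have "E1_zero q \<in> (E1 q :: ('n heis \<Rightarrow> complex) set set)"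
    unfolding E1_def E1_zero_def using zero by (rule quotientI)
  ultimately show ?thesis by (simp add: orlicz_calderon_hardy_def)
qed

theorem theorem53:
  fixes \<Phi> :: "real \<Rightarrow> real" and q Q :: real
  assumes "Q = 2 * real CARD('n::finite) + 2"
    and "1 < q" and "q < (real CARD('n) + 1) / real CARD('n)"
    and "orlicz_function TYPE('n) \<Phi>"
    and "0 < upper_index \<Phi>" and "upper_index \<Phi> < ereal (Q * inverse (2 + Q / q))"
  shows "(orlicz_calderon_hardy \<Phi> q :: ('n heis \<Rightarrow> complex) set set) = {E1_zero q}"
proof (intro equalityI subsetI)
  fix G :: "('n heis \<Rightarrow> complex) set"
  assume G: "G \<in> orlicz_calderon_hardy \<Phi> q"
  then obtain g where g: "g \<in> Lq_loc q" and G_eq: "G = E1_rel q `` {g}"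
    by (auto simp: orlicz_calderon_hardy_def E1_def elim!: quotientE)
  have a: "0 < 2 + Q / q"
    using assms(1,2) by (auto intro!: add_pos_nonneg)
  obtain p where p: "positive_upper_type \<Phi> p" and "p < Q * inverse (2 + Q / q)"
    using assms(6) unfolding upper_index_def INF_less_iff by auto
  then have pa: "p * (2 + Q / q) < 2 * real CARD('n) + 2"
    using a assms(1) by (simp add: field_simps)
  have "\<exists>c. AE z in lebesgue. g z = heis_affine c z"
  proof (rule ccontr)
    assume "\<not> ?thesis"
    then obtain k R\<^sub>0 where "0 < k" "1 \<le> R\<^sub>0"
      and "\<And>R z. R\<^sub>0 \<le> R \<Longrightarrow> z \<in> heis_box R \<Longrightarrow>
        ennreal (k * R powr - (2 + Q / q)) \<le> calderon_N q (E1_rel q `` {g}) z"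
      using calderon_N_lower_bound[OF assms(1,2) g] by blast
    then have "luxemburg \<Phi> (calderon_N q G) = \<infinity>"
      unfolding G_eq by (rule luxemburg_infinite_if_slow_decay[OF assms(4) p a pa])
    then show False
      using G by (simp add: orlicz_calderon_hardy_def orlicz_space_def)
  qed
  then show "G \<in> {E1_zero q}"
    using E1_rel_image_eq_E1_zero[OF g] G_eq by blast
next
  fix G :: "('n heis \<Rightarrow> complex) set"
  assume "G \<in> {E1_zero q}"
  then show "G \<in> orlicz_calderon_hardy \<Phi> q"
    using E1_zero_in_orlicz_calderon_hardy[OF assms(4)] by simp
qed

end
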